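(* Let $\mu$ be a probability measure on $\mathbb{R}^d$ that is absolutely continuous with respect to Lebesgue measure and let $t>0$. For $s\ge 0$ let $\Pi_s$ denote the convex hull of the points of a Poisson point process on $\mathbb{R}^d$ with intensity measure $s\mu$, let $N(\Pi_s)$ be the number of vertices of $\Pi_s$, and let $\Delta(\Pi_s)=\mu(\mathbb{R}^d\setminus\Pi_s)$. Then for every $x\in[0,1]$, $$g_{N(\Pi_t)}(x)=h_{\Delta(\Pi_{xt})}(t(x-1)),$$ where $g_X(z)=\mathbb{E}\, z^X$ is the generating function and $h_X(z)=\mathbb{E}\, e^{zX}$ the moment generating function of a random variable $X$.
   Context: A Poisson point process with intensity measure $s\mu$ is a random finite simple counting measure $\eta$ such that $\eta(A)$ is Poisson distributed with parameter $s\mu(A)$ for every Borel set $A$ and counts of pairwise disjoint Borel sets are independent. The convex hull of the empty set is empty. *)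

theory Defs
  imports "HOL-Probability.Probability"
begin

definition poisson_point_process ::
  "'w measure \<Rightarrow> ('w \<Rightarrow> 'a::euclidean_space set) \<Rightarrow> 'a measure \<Rightarrow> real \<Rightarrow> bool" where
  "poisson_point_process M eta mu s \<longleftrightarrow>
     prob_space M \<and>
     (\<forall>w\<in>space M. finite (eta w)) \<and>
     (\<forall>A\<in>sets borel.
        (\<lambda>w. card (eta w \<inter> A)) \<in> measurable M (count_space UNIV) \<and>
        (\<forall>k::nat. measure M {w\<in>space M. card (eta w \<inter> A) = k}
                   = (s * measure mu A) ^ k / fact k * exp (- (s * measure mu A)))) \<and>
     (\<forall>(As :: nat \<Rightarrow> 'a set) I.
        (\<forall>i\<in>I. As i \<in> sets borel) \<and> disjoint_family_on As I \<longrightarrow>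
        prob_space.indep_vars M (\<lambda>_. count_space UNIV) (\<lambda>i w. card (eta w \<inter> As i)) I)"

definition num_vertices :: "'a::euclidean_space set \<Rightarrow> nat" where
  "num_vertices P = card {v. v extreme_point_of (convex hull P)}"

definition missed_mass :: "'a::euclidean_space measure \<Rightarrow> 'a set \<Rightarrow> real" where
  "missed_mass mu P = measure mu (UNIV - convex hull P)"

end

theory Submission
  imports Defs
begin

text \<open>
  Couple the two processes by marking: take a Poisson(t) number of independent points with law mu and
  keep each one independently with probability x.  The kept points K and the deleted points D
  are independent Poisson processes with intensities x t mu and (1 - x) t mu, and their union has
  intensity t mu.  Almost surely D lies in the hull of K iff every vertex of the hull of
  the union was kept.  Conditioning on the union, this event has probability
  E x^N; conditioning on K, it has probability E exp (- (1 - x) t Delta).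

  Laws of finite random sets are compared through their void probabilities (Renyi): the events
  ``no point in A'' are stable under intersection, and they generate the sigma-algebra used here.
\<close>

section \<open>Separation by countably many half-spaces\<close>

text \<open>Strict separation of \<open>z\<close> from a finite set is an open condition on the pair
  of normal and offset, so a countable dense set of pairs suffices. This countability later turns
  statements about hulls into countable unions of measurable events.\<close>

lemma countable_halfspaces:
  obtains C :: "('a::euclidean_space \<times> real) set" where "countable C"
    and "\<And>(K::'a set) z. finite K \<Longrightarrow> z \<notin> convex hull K \<Longrightarrow>
           \<exists>(a, b)\<in>C. b < a \<bullet> z \<and> (\<forall>y\<in>K. a \<bullet> y \<le> b)"
proof -
  obtain C :: "('a \<times> real) set" where C: "countable C" "\<And>X. open X \<Longrightarrow> X \<noteq> {} \<Longrightarrow> \<exists>d \<in> C. d \<in> X"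
    by (rule countable_dense_setE) blast
  show thesis
  proof
    fix K :: "'a set" and z assume K: "finite K" "z \<notin> convex hull K"
    obtain a b where ab: "a \<bullet> z < b" "\<forall>x\<in>convex hull K. a \<bullet> x > b"
      using separating_hyperplane_closed_point[of "convex hull K" z] K
      by (auto simp: finite_imp_compact_convex_hull compact_imp_closed)
    let ?X = "{p::'a \<times> real. snd p < fst p \<bullet> z} \<inter> (\<Inter>y\<in>K. {p. fst p \<bullet> y < snd p})"
    have "open ?X"
      using K by (intro open_Int open_INT ballI open_Collect_less) (auto intro!: continuous_intros)
    \<comment> \<open>The hyperplane obtained above has \<open>z\<close> on its lower side, whereas
      \<open>?X\<close> wants it on the upper one.\<close>
    moreover have "(-a, -b) \<in> ?X"
      using ab by (auto simp: hull_inc)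
    ultimately obtain d where "d \<in> C" "d \<in> ?X"
      using C(2)[of ?X] by blast
    then show "\<exists>(a, b)\<in>C. b < a \<bullet> z \<and> (\<forall>y\<in>K. a \<bullet> y \<le> b)"
      by (intro bexI[of _ d]) (auto simp: less_imp_le)
  qed fact
qed

section \<open>Finite sets under the void sigma-algebra\<close>

abbreviation vertices :: "'a::euclidean_space set \<Rightarrow> 'a set" where
  "vertices S \<equiv> {v. v extreme_point_of (convex hull S)}"

definition void :: "'a set \<Rightarrow> 'a set set" where
  "void A = {S. finite S \<and> S \<inter> A = {}}"

text \<open>Void events alone generate the sigma-algebra, so equality of laws is checked on a class
  closed under intersection; measurability of counts then has to be derived.\<close>

definition config :: "'a::topological_space set measure" where
  "config = sigma {S. finite S} (void ` sets borel)"

lemma void_subset: "void ` X \<subseteq> Pow {S. finite S}"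
  by (auto simp: void_def)

lemma space_config [simp]: "space config = {S. finite S}"
  by (simp add: config_def space_measure_of void_subset)

lemma sets_config: "sets config = sigma_sets {S. finite S} (void ` sets borel)"
  by (simp add: config_def sets_measure_of void_subset)

lemma void_in_sets [measurable, simp]: "A \<in> sets borel \<Longrightarrow> void A \<in> sets config"
  by (auto simp: sets_config)

lemma void_empty: "void {} = {S. finite S}"
  by (simp add: void_def)

lemma void_Int: "void A \<inter> void B = void (A \<union> B)"
  by (auto simp: void_def)

lemma measurable_config:
  assumes "\<And>w. w \<in> space M \<Longrightarrow> finite (f w)"
    and "\<And>A. A \<in> sets borel \<Longrightarrow> {w\<in>space M. f w \<inter> A = {}} \<in> sets M"
  shows "f \<in> measurable M config"
proof (unfold config_def, rule measurable_measure_of)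
  show "void ` sets borel \<subseteq> Pow {S::'b set. finite S}"
    by (rule void_subset)
  fix Y assume "Y \<in> void ` sets (borel :: 'b measure)"
  then obtain A where A: "A \<in> sets borel" "Y = void A" by auto
  have "f -` Y \<inter> space M = {w\<in>space M. f w \<inter> A = {}}"
    using assms(1) by (auto simp: A void_def)
  then show "f -` Y \<inter> space M \<in> sets M"
    using assms(2)[OF A(1)] by simp
qed (use assms in auto)

lemma config_law_eqI:
  fixes P Q :: "'a::topological_space set measure"
  assumes "sets P = sets config" "sets Q = sets config" "finite_measure P"
    and "\<And>A. A \<in> sets borel \<Longrightarrow> emeasure P (void A) = emeasure Q (void A)"
  shows "P = Q"
proof (rule measure_eqI_generator_eq)
  show "Int_stable (void ` sets (borel :: 'a measure))"
    by (auto simp: Int_stable_def void_Int)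
  show "void ` sets borel \<subseteq> Pow {S::'a set. finite S}"
    by (rule void_subset)
  show "range (\<lambda>i::nat. void {}) \<subseteq> void ` sets (borel :: 'a measure)" by auto
  show "emeasure P (void {}) \<noteq> \<infinity>"
    using assms(3) by (simp add: finite_measure.emeasure_finite)
qed (use assms in \<open>auto simp: sets_config void_empty\<close>)

text \<open>Rectangles of void events form an intersection-stable generator of the product
  sigma-algebra. The version for pairs is what yields the independence of kept and deleted
  points.\<close>

lemma config_pair_law_eqI:
  fixes P Q :: "('a::topological_space set \<times> 'a set) measure"
  assumes P: "sets P = sets (config \<Otimes>\<^sub>M config)" and Q: "sets Q = sets (config \<Otimes>\<^sub>M config)"
    and fin: "finite_measure P"
    and eq: "\<And>A B. A \<in> sets borel \<Longrightarrow> B \<in> sets borel \<Longrightarrow>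
               emeasure P (void A \<times> void B) = emeasure Q (void A \<times> void B)"
  shows "P = Q"
proof (rule measure_eqI_generator_eq)
  let ?F = "{S :: 'a set. finite S}"
  let ?V = "void ` sets (borel :: 'a measure)"
  let ?E = "{a \<times> b | a b. a \<in> ?V \<and> b \<in> ?V}"
  have "void {} \<in> ?V" by auto
  then have gen: "sets (config \<Otimes>\<^sub>M config) = sets (sigma (?F \<times> ?F) ?E)"
    using sets_pair_eq[of ?V config "{void {}}" ?V config "{void {}}"]
    by (simp add: void_subset sets_config void_empty)
  show sub: "?E \<subseteq> Pow (?F \<times> ?F)"
    using void_subset[of "sets borel"] by blast
  show "sets P = sigma_sets (?F \<times> ?F) ?E" "sets Q = sigma_sets (?F \<times> ?F) ?E"
    using gen P Q sub by (simp_all add: sets_measure_of)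
  show "Int_stable ?E"
  proof (rule Int_stableI)
    fix x y assume "x \<in> ?E" "y \<in> ?E"
    then obtain A B A' B' where *: "A \<in> sets borel" "B \<in> sets borel" "A' \<in> sets borel" "B' \<in> sets borel"
      "x = void A \<times> void B" "y = void A' \<times> void B'" by blast
    then have "x \<inter> y = void (A \<union> A') \<times> void (B \<union> B')"
      by (simp add: Times_Int_Times void_Int)
    then show "x \<inter> y \<in> ?E"
      using * by blast
  qed
  show "range (\<lambda>i::nat. void {} \<times> void {}) \<subseteq> ?E"
    by blast
  show "emeasure P (void {} \<times> void {}) \<noteq> \<infinity>"
    using fin by (simp add: finite_measure.emeasure_finite)
qed (use eq in \<open>auto simp: void_empty\<close>)

text \<open>Counts are recovered from void events by induction: a finite set has more than
  \<open>k\<close> points iff some basic open set meets it and leaves at least \<open>k\<close>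
  points outside. A countable basis keeps the union countable.\<close>

lemma measurable_card_config:
  "(card :: 'a::euclidean_space set \<Rightarrow> nat) \<in> measurable config (count_space UNIV)"
proof -
  obtain B :: "'a set set" where B: "countable B" "topological_basis B"
    using ex_countable_basis by blast
  then have bB: "U \<in> B \<Longrightarrow> U \<in> sets borel" for U
    by (simp add: topological_basis_open)
  have diff: "(\<lambda>S. S - U) \<in> measurable config config" if "U \<in> B" for U
  proof (rule measurable_config)
    fix A :: "'a set" assume "A \<in> sets borel"
    moreover have "{S \<in> space config. (S - U) \<inter> A = {}} = void (A - U)"
      by (auto simp: void_def)
    ultimately show "{S \<in> space config. (S - U) \<inter> A = {}} \<in> sets config"
      using that bB by simp
  qed simp
  have step: "Suc k \<le> card S \<longleftrightarrow> (\<exists>U\<in>B. S \<notin> void U \<and> k \<le> card (S - U))"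
    if "finite S" for S :: "'a set" and k
  proof safe
    assume *: "Suc k \<le> card S"
    then obtain v where v: "v \<in> S" by fastforce
    \<comment> \<open>The other points form a closed set, so a basic open set isolates
      \<open>v\<close> and removes exactly that point.\<close>
    have "open (- (S - {v}))"
      using that by (intro open_Compl finite_imp_closed) auto
    then obtain U where U: "U \<in> B" "v \<in> U" "U \<subseteq> - (S - {v})"
      using topological_basisE[OF B(2), of "- (S - {v})" v] by auto
    then have "S - U = S - {v}" using v by auto
    then show "\<exists>U\<in>B. S \<notin> void U \<and> k \<le> card (S - U)"
      using U v * that by (intro bexI[of _ U]) (auto simp: void_def)
  next
    fix U assume "U \<in> B" "S \<notin> void U" "k \<le> card (S - U)"
    moreover have "card (S - U) < card S"
      using \<open>S \<notin> void U\<close> that by (intro psubset_card_mono) (auto simp: void_def)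
    ultimately show "Suc k \<le> card S" by simp
  qed
  have ge: "{S \<in> space config. k \<le> card (S :: 'a set)} \<in> sets config" for k
  proof (induction k)
    case 0
    show ?case using sets.top[of "config :: 'a set measure"] by simp
  next
    case (Suc k)
    have "{S \<in> space config. Suc k \<le> card S}
        = (\<Union>U\<in>B. ((\<lambda>S. S - U) -` {S \<in> space config. k \<le> card S} \<inter> space config) - void U)"
      by (auto simp: step)
    also have "\<dots> \<in> sets config"
      by (intro sets.countable_UN'' B sets.Diff measurable_sets[OF diff Suc] void_in_sets bB)
    finally show ?case .
  qed
  have eq: "card -` {k} \<inter> space config
      = {S \<in> space config. k \<le> card S} - {S \<in> space config. Suc k \<le> card (S :: 'a set)}" for k
    by auto
  have "card -` {k} \<inter> space config \<in> sets (config :: 'a set measure)" for k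
    unfolding eq by (intro sets.Diff ge)
  then show ?thesis
    by (subst measurable_count_space_eq2_countable) auto
qed

section \<open>Vertices of hulls of finite sets and their measurability\<close>

lemma vertices_subset: "vertices S \<subseteq> S"
  by (rule extreme_points_of_convex_hull)

lemma convex_hull_vertices:
  "finite S \<Longrightarrow> convex hull (vertices S) = convex hull (S :: 'a::euclidean_space set)"
  using Krein_Milman_Minkowski[of "convex hull S"]
  by (simp add: finite_imp_compact_convex_hull)

text \<open>Removing an extreme point keeps the hull convex, and what is left still contains the
  other points of \<open>S\<close>, hence their hull.\<close>

lemma vertex_notin_hull_others:
  assumes "v \<in> vertices S" shows "v \<notin> convex hull (S - {v})"
proof -
  have "convex (convex hull S - {v})"
    using assms by (simp add: extreme_point_of_stillconvex)
  moreover have "S - {v} \<subseteq> convex hull S - {v}"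
    by (meson Diff_mono hull_subset order_refl)
  ultimately have "convex hull (S - {v}) \<subseteq> convex hull S - {v}"
    by (rule hull_minimal[rotated])
  then show ?thesis by blast
qed

lemma measurable_vertices:
  "(vertices :: 'a::euclidean_space set \<Rightarrow> 'a set) \<in> measurable config config"
proof (rule measurable_config)
  fix S :: "'a set" assume "S \<in> space config"
  then show "finite (vertices S)"
    using finite_subset[OF vertices_subset] by simp
next
  fix U :: "'a set" assume U: "U \<in> sets borel"
  obtain C :: "('a \<times> real) set" where C: "countable C"
    "\<And>(K::'a set) z. finite K \<Longrightarrow> z \<notin> convex hull K \<Longrightarrow>
           \<exists>(a, b)\<in>C. b < a \<bullet> z \<and> (\<forall>y\<in>K. a \<bullet> y \<le> b)"
    using countable_halfspaces by blast
  let ?H = "\<lambda>p::'a \<times> real. {y. snd p < fst p \<bullet> y}"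
  have H: "?H p \<in> sets borel" for p
    by (intro borel_open open_Collect_less continuous_intros)
  \<comment> \<open>A vertex of S lies in U iff some half-space meets S, but only inside U.\<close>
  have "vertices S \<inter> U \<noteq> {} \<longleftrightarrow> (\<exists>p\<in>C. S \<in> void (?H p - U) - void (?H p))"
    if S: "finite S" for S
  proof (intro iffI)
    assume "vertices S \<inter> U \<noteq> {}"
    then obtain v where v: "v extreme_point_of (convex hull S)" "v \<in> U" by blast
    \<comment> \<open>\<open>v\<close> lies outside the hull of the other points, so some half-space
      from \<open>C\<close> contains \<open>v\<close> and no other point of
      \<open>S\<close>.\<close>
    then obtain a b where "(a, b) \<in> C" "b < a \<bullet> v" "\<forall>y\<in>S - {v}. a \<bullet> y \<le> b"
      using C(2)[of "S - {v}" v] S vertex_notin_hull_others[of v S] by blast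
    moreover have "v \<in> S" using v by (simp add: extreme_point_of_convex_hull)
    ultimately show "\<exists>p\<in>C. S \<in> void (?H p - U) - void (?H p)"
      using S v by (intro bexI[of _ "(a, b)"]) (force simp: void_def)+
  next
    assume "\<exists>p\<in>C. S \<in> void (?H p - U) - void (?H p)"
    then obtain a b where p: "S \<in> void (?H (a, b) - U)" "S \<notin> void (?H (a, b))" by auto
    show "vertices S \<inter> U \<noteq> {}"
    proof
      assume none: "vertices S \<inter> U = {}"
      \<comment> \<open>Points of \<open>S\<close> in the half-space lie in \<open>U\<close>, so
        without vertices in \<open>U\<close> all vertices, and with them the whole hull, lie on the
        other side.\<close>
      have "vertices S \<subseteq> {y. a \<bullet> y \<le> b}"
        using vertices_subset[of S] none p by (fastforce simp: void_def not_less)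
      then have "convex hull (vertices S) \<subseteq> {y. a \<bullet> y \<le> b}"
        by (rule hull_minimal) (rule convex_halfspace_le)
      then have "S \<subseteq> {y. a \<bullet> y \<le> b}"
        using hull_subset[of S convex] by (auto simp: convex_hull_vertices[OF S])
      then show False
        using p(2) S by (fastforce simp: void_def)
    qed
  qed
  then have "{S \<in> space config. vertices S \<inter> U = {}}
      = space config - (\<Union>p\<in>C. void (?H p - U) - void (?H p))"
    by auto
  also have "\<dots> \<in> sets config"
    using C(1) H U by (intro sets.Diff sets.top sets.countable_UN'' void_in_sets) auto
  finally show "{S \<in> space config. vertices S \<inter> U = {}} \<in> sets config" .
qed

lemma measurable_num_vertices:
  "(num_vertices :: 'a::euclidean_space set \<Rightarrow> nat) \<in> measurable config (count_space UNIV)"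
  using measurable_comp[OF measurable_vertices measurable_card_config]
  by (simp add: num_vertices_def[abs_def] comp_def)

text \<open>\<open>D\<close> leaves the hull of \<open>K\<close> iff some half-space from a
  countable family misses \<open>K\<close> but meets \<open>D\<close>; so the complement is a
  countable union of rectangles.\<close>

lemma sets_subset_hull:
  "{(K, D). finite K \<and> finite D \<and> D \<subseteq> convex hull (K :: 'a::euclidean_space set)}
    \<in> sets (config \<Otimes>\<^sub>M config)" (is "?G \<in> _")
proof -
  obtain C :: "('a \<times> real) set" where C: "countable C"
    "\<And>(K::'a set) z. finite K \<Longrightarrow> z \<notin> convex hull K \<Longrightarrow>
           \<exists>(a, b)\<in>C. b < a \<bullet> z \<and> (\<forall>y\<in>K. a \<bullet> y \<le> b)"
    using countable_halfspaces by blast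
  let ?H = "\<lambda>p::'a \<times> real. {y. snd p < fst p \<bullet> y}"
  have H: "?H p \<in> sets borel" for p
    by (intro borel_open open_Collect_less continuous_intros)
  have "\<not> D \<subseteq> convex hull K \<longleftrightarrow> (\<exists>p\<in>C. K \<in> void (?H p) \<and> D \<notin> void (?H p))"
    if KD: "finite K" "finite D" for K D
  proof (intro iffI)
    assume "\<not> D \<subseteq> convex hull K"
    then obtain z where "z \<in> D" "z \<notin> convex hull K" by blast
    with C(2)[OF KD(1)] obtain a b where "(a, b) \<in> C" "b < a \<bullet> z" "\<forall>y\<in>K. a \<bullet> y \<le> b"
      by blast
    then show "\<exists>p\<in>C. K \<in> void (?H p) \<and> D \<notin> void (?H p)"
      using KD \<open>z \<in> D\<close> by (intro bexI[of _ "(a, b)"]) (force simp: void_def)+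
  next
    assume "\<exists>p\<in>C. K \<in> void (?H p) \<and> D \<notin> void (?H p)"
    then obtain a b where p: "K \<in> void (?H (a, b))" "D \<notin> void (?H (a, b))" by auto
    have "K \<subseteq> {y. a \<bullet> y \<le> b}"
      using p by (fastforce simp: void_def not_less)
    then have "convex hull K \<subseteq> {y. a \<bullet> y \<le> b}"
      by (rule hull_minimal) (rule convex_halfspace_le)
    then show "\<not> D \<subseteq> convex hull K"
      using p(2) KD by (fastforce simp: void_def)
  qed
  then have "?G = space (config \<Otimes>\<^sub>M config) - (\<Union>p\<in>C. void (?H p) \<times> (space config - void (?H p)))"
    by (auto simp: space_pair_measure)
  also have "\<dots> \<in> sets (config \<Otimes>\<^sub>M config)"
    using C(1) H by (intro sets.Diff sets.top sets.countable_UN'' void_in_sets pair_measureI) auto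
  finally show ?thesis .
qed

section \<open>The marking coupling\<close>

locale marking = prob_space mu for mu :: "'a::euclidean_space measure" +
  fixes t x :: real
  assumes sets_mu [simp, measurable_cong]: "sets mu = sets borel"
    and t: "0 < t" and x: "0 \<le> x" "x \<le> 1"
begin

lemma space_mu [simp]: "space mu = UNIV"
  using sets_eq_imp_space_eq[OF sets_mu] by simp

abbreviation points :: "nat \<Rightarrow> (nat \<Rightarrow> 'a) measure" where
  "points n \<equiv> PiM {..<n} (\<lambda>_. mu)"

abbreviation marks :: "nat \<Rightarrow> (nat \<Rightarrow> bool) measure" where
  "marks n \<equiv> PiM {..<n} (\<lambda>_. measure_pmf (bernoulli_pmf x))"

text \<open>The pair is (kept, deleted). Taking images forgets the indices, so coinciding positions
  merge and could even land in both sets; \<open>AE_points_inj\<close> excludes this almost surely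
  for diffuse \<open>mu\<close>.\<close>

definition thin :: "nat \<Rightarrow> (nat \<Rightarrow> 'a) \<times> (nat \<Rightarrow> bool) \<Rightarrow> 'a set \<times> 'a set" where
  "thin n = (\<lambda>(X, B). (X ` {i. i < n \<and> B i}, X ` {i. i < n \<and> \<not> B i}))"

definition coupling_n :: "nat \<Rightarrow> ('a set \<times> 'a set) measure" where
  "coupling_n n = distr (points n \<Otimes>\<^sub>M marks n) (config \<Otimes>\<^sub>M config) (thin n)"

definition coupling :: "('a set \<times> 'a set) measure" where
  "coupling = measure_pmf (poisson_pmf t) \<bind> coupling_n"

lemma prob_space_points: "prob_space (points n)"
  by (intro prob_space_PiM prob_space_axioms)

lemma prob_space_marks: "prob_space (marks n)"
  by (intro prob_space_PiM prob_space_measure_pmf)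

lemma measurable_thin [measurable]:
  "thin n \<in> measurable (points n \<Otimes>\<^sub>M marks n) (config \<Otimes>\<^sub>M config)"
proof -
  let ?P = "points n \<Otimes>\<^sub>M marks n"
  have "(\<lambda>w. fst w ` {i. i < n \<and> snd w i}) \<in> measurable ?P config"
  proof (rule measurable_config)
    fix A :: "'a set" assume [measurable]: "A \<in> sets borel"
    have "{w \<in> space ?P. \<forall>i\<in>{..<n}. snd w i \<longrightarrow> fst w i \<notin> A} \<in> sets ?P"
      by measurable
    also have "{w \<in> space ?P. \<forall>i\<in>{..<n}. snd w i \<longrightarrow> fst w i \<notin> A}
        = {w \<in> space ?P. fst w ` {i. i < n \<and> snd w i} \<inter> A = {}}"
      by auto
    finally show "{w \<in> space ?P. fst w ` {i. i < n \<and> snd w i} \<inter> A = {}} \<in> sets ?P" .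
  qed simp
  moreover have "(\<lambda>w. fst w ` {i. i < n \<and> \<not> snd w i}) \<in> measurable ?P config"
  proof (rule measurable_config)
    fix A :: "'a set" assume [measurable]: "A \<in> sets borel"
    have "{w \<in> space ?P. \<forall>i\<in>{..<n}. \<not> snd w i \<longrightarrow> fst w i \<notin> A} \<in> sets ?P"
      by measurable
    also have "{w \<in> space ?P. \<forall>i\<in>{..<n}. \<not> snd w i \<longrightarrow> fst w i \<notin> A}
        = {w \<in> space ?P. fst w ` {i. i < n \<and> \<not> snd w i} \<inter> A = {}}"
      by auto
    finally show "{w \<in> space ?P. fst w ` {i. i < n \<and> \<not> snd w i} \<inter> A = {}} \<in> sets ?P" .
  qed simp
  ultimately show ?thesis
    unfolding thin_def by (simp add: case_prod_unfold)
qed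

lemma sets_coupling_n [simp]: "sets (coupling_n n) = sets (config \<Otimes>\<^sub>M config)"
  by (simp add: coupling_n_def)

lemma prob_space_coupling_n: "prob_space (coupling_n n)"
  unfolding coupling_n_def
  by (intro prob_space.prob_space_distr prob_space_pair prob_space_points prob_space_marks) measurable

lemma measurable_coupling_n:
  "coupling_n \<in> measurable (measure_pmf p) (subprob_algebra (config \<Otimes>\<^sub>M config))"
  using prob_space_coupling_n
  by (auto simp: measurable_def space_subprob_algebra intro: prob_space_imp_subprob_space)

lemma sets_coupling [simp]: "sets coupling = sets (config \<Otimes>\<^sub>M config)"
  unfolding coupling_def by (rule sets_bind[of _ _ "config \<Otimes>\<^sub>M config"]) auto

lemma measurable_coupling_iff [simp]:
  "measurable coupling N = measurable (config \<Otimes>\<^sub>M config) N"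
  by (rule measurable_cong_sets) simp_all

lemma space_coupling [simp]: "space coupling = {S. finite S} \<times> {S. finite S}"
  using sets_eq_imp_space_eq[OF sets_coupling] by (simp add: space_pair_measure)

lemma emeasure_coupling:
  "E \<in> sets (config \<Otimes>\<^sub>M config) \<Longrightarrow>
     emeasure coupling E = (\<integral>\<^sup>+ n. emeasure (coupling_n n) E \<partial>measure_pmf (poisson_pmf t))"
  unfolding coupling_def by (rule emeasure_bind[OF _ measurable_coupling_n]) auto

lemma nn_integral_coupling:
  "f \<in> borel_measurable (config \<Otimes>\<^sub>M config) \<Longrightarrow>
     (\<integral>\<^sup>+ w. f w \<partial>coupling) = (\<integral>\<^sup>+ n. \<integral>\<^sup>+ w. f w \<partial>coupling_n n \<partial>measure_pmf (poisson_pmf t))"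
  unfolding coupling_def by (rule nn_integral_bind[OF _ measurable_coupling_n])

section \<open>Void probabilities of the coupling\<close>

lemma product_sigma_finite_marks: "product_sigma_finite (\<lambda>_. measure_pmf (bernoulli_pmf x))"
  by (simp add: product_sigma_finite_def prob_space_imp_sigma_finite prob_space_measure_pmf)

lemma product_sigma_finite_points: "product_sigma_finite (\<lambda>_. mu)"
  by (simp add: product_sigma_finite_def prob_space_imp_sigma_finite prob_space_axioms)

text \<open>Integrating over the marks first, with the positions fixed, reduces the computations
  below to independent coin flips.\<close>

lemma emeasure_coupling_n_iterated:
  assumes E [measurable]: "E \<in> sets (config \<Otimes>\<^sub>M config)"
  shows "emeasure (coupling_n n) E
     = (\<integral>\<^sup>+ X. \<integral>\<^sup>+ B. indicator E (thin n (X, B)) \<partial>marks n \<partial>points n)"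
proof -
  interpret marks: prob_space "marks n" by (rule prob_space_marks)
  have "emeasure (coupling_n n) E = (\<integral>\<^sup>+ w. indicator E w \<partial>coupling_n n)"
    using E by simp
  also have "\<dots> = (\<integral>\<^sup>+ w. indicator E (thin n w) \<partial>(points n \<Otimes>\<^sub>M marks n))"
    unfolding coupling_n_def by (intro nn_integral_distr) measurable
  also have "\<dots> = (\<integral>\<^sup>+ X. \<integral>\<^sup>+ B. indicator E (thin n (X, B)) \<partial>marks n \<partial>points n)"
    by (intro marks.nn_integral_fst[symmetric]) measurable
  finally show ?thesis .
qed

text \<open>A single point is admissible if it is kept and avoids \<open>A\<close>, or deleted and
  avoids \<open>B\<close>; this has probability
  \<open>x * (1 - mu A) + (1 - x) * (1 - mu B)\<close>. The points with their marks are independent,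
  whence the power.\<close>

lemma emeasure_coupling_n_void:
  assumes A [measurable]: "A \<in> sets borel" and B [measurable]: "B \<in> sets borel"
  shows "emeasure (coupling_n n) (void A \<times> void B)
     = ennreal ((1 - x * measure mu A - (1 - x) * measure mu B) ^ n)"
proof -
  let ?f = "\<lambda>y b. if b then indicator (- A) y else (indicator (- B) y :: ennreal)"
  have "emeasure (coupling_n n) (void A \<times> void B)
      = (\<integral>\<^sup>+ X. \<integral>\<^sup>+ b. indicator (void A \<times> void B) (thin n (X, b)) \<partial>marks n \<partial>points n)"
    by (intro emeasure_coupling_n_iterated) simp
  also have "\<dots> = (\<integral>\<^sup>+ X. \<integral>\<^sup>+ b. (\<Prod>i<n. ?f (X i) (b i)) \<partial>marks n \<partial>points n)"
  proof (intro nn_integral_cong)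
    fix X and b :: "nat \<Rightarrow> bool"
    show "indicator (void A \<times> void B) (thin n (X, b)) = (\<Prod>i<n. ?f (X i) (b i))"
    proof (cases "\<forall>i<n. if b i then X i \<notin> A else X i \<notin> B")
      case True
      then have "thin n (X, b) \<in> void A \<times> void B"
        by (auto simp: thin_def void_def split: if_splits)
      moreover have "(\<Prod>i<n. ?f (X i) (b i)) = 1"
        using True by (intro prod.neutral) auto
      ultimately show ?thesis by simp
    next
      case False
      then have "thin n (X, b) \<notin> void A \<times> void B"
        by (auto simp: thin_def void_def split: if_splits)
      moreover have "(\<Prod>i<n. ?f (X i) (b i)) = 0"
        using False by (intro prod_zero) (auto simp: indicator_def split: if_splits)
      ultimately show ?thesis by simp
    qed
  qed
  also have "\<dots> = (\<integral>\<^sup>+ X. (\<Prod>i<n. \<integral>\<^sup>+ b. ?f (X i) b \<partial>bernoulli_pmf x) \<partial>points n)"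
    by (intro nn_integral_cong product_sigma_finite.product_nn_integral_prod[OF product_sigma_finite_marks])
       auto
  also have "\<dots> = (\<integral>\<^sup>+ X. (\<Prod>i<n. indicator (- A) (X i) * ennreal x + indicator (- B) (X i) * ennreal (1 - x)) \<partial>points n)"
    using x by (simp add: ennreal_minus flip: ennreal_1)
  also have "\<dots> = (\<Prod>i<n. \<integral>\<^sup>+ y. indicator (- A) y * ennreal x + indicator (- B) y * ennreal (1 - x) \<partial>mu)"
    by (intro product_sigma_finite.product_nn_integral_prod[OF product_sigma_finite_points]) auto
  also have "(\<integral>\<^sup>+ y. indicator (- A) y * ennreal x + indicator (- B) y * ennreal (1 - x) \<partial>mu)
      = emeasure mu (- A) * ennreal x + emeasure mu (- B) * ennreal (1 - x)"
    by (subst nn_integral_add) (auto simp: nn_integral_multc)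
  also have "\<dots> = ennreal (1 - x * measure mu A - (1 - x) * measure mu B)"
  proof -
    have compl: "measure mu (- A) = 1 - measure mu A" "measure mu (- B) = 1 - measure mu B"
      using prob_compl[of A] prob_compl[of B] by (simp_all add: Compl_eq_Diff_UNIV)
    have "measure mu (- A) * x + measure mu (- B) * (1 - x)
        = 1 - x * measure mu A - (1 - x) * measure mu B"
      unfolding compl by (simp add: algebra_simps)
    then show ?thesis
      using x by (simp add: emeasure_eq_measure flip: ennreal_mult ennreal_plus)
  qed
  also have "(\<Prod>i<n. ennreal (1 - x * measure mu A - (1 - x) * measure mu B))
     = ennreal ((1 - x * measure mu A - (1 - x) * measure mu B) ^ n)"
  proof -
    \<comment> \<open>A convex combination of probabilities is at most 1, so the base of the power
      is non-negative, as \<open>ennreal_power\<close> requires.\<close>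
    have "x * measure mu A + (1 - x) * measure mu B \<le> x * 1 + (1 - x) * 1"
      using x by (intro add_mono mult_left_mono) auto
    then show ?thesis by (simp add: ennreal_power)
  qed
  finally show ?thesis .
qed

text \<open>This is the generating function of the Poisson law, obtained from the exponential
  series.\<close>

lemma nn_integral_poisson_power:
  assumes "0 \<le> p"
  shows "(\<integral>\<^sup>+ n. ennreal (p ^ n) \<partial>measure_pmf (poisson_pmf t)) = ennreal (exp (t * (p - 1)))"
proof -
  have sums: "(\<lambda>n. t ^ n / fact n * exp (- t) * p ^ n) sums exp (t * (p - 1))"
  proof -
    have "(\<lambda>n. exp (- t) * ((t * p) ^ n /\<^sub>R fact n)) sums (exp (- t) * exp (t * p))"
      by (intro sums_mult exp_converges)
    then show ?thesis
      by (simp add: power_mult_distrib divide_inverse mult_ac right_diff_distrib flip: exp_add)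
  qed
  have "(\<integral>\<^sup>+ n. ennreal (p ^ n) \<partial>measure_pmf (poisson_pmf t))
      = (\<Sum>n. ennreal (t ^ n / fact n * exp (- t) * p ^ n))"
    using t assms
    by (simp add: nn_integral_measure_pmf nn_integral_count_space_nat flip: ennreal_mult)
  also have "\<dots> = ennreal (exp (t * (p - 1)))"
    using sums t assms by (subst suminf_ennreal2) (auto simp: sums_iff)
  finally show ?thesis .
qed

text \<open>With the one-point probability as argument of the Poisson generating function, the
  exponent becomes additive in \<open>A\<close> and \<open>B\<close>. The resulting factorisation
  encodes the independence of kept and deleted points.\<close>

lemma emeasure_coupling_void:
  assumes "A \<in> sets borel" "B \<in> sets borel"
  shows "emeasure coupling (void A \<times> void B)
     = ennreal (exp (- (x * t * measure mu A)) * exp (- ((1 - x) * t * measure mu B)))"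
proof -
  have "x * measure mu A + (1 - x) * measure mu B \<le> x * 1 + (1 - x) * 1"
    using x by (intro add_mono mult_left_mono) auto
  then have "emeasure coupling (void A \<times> void B)
      = ennreal (exp (t * ((1 - x * measure mu A - (1 - x) * measure mu B) - 1)))"
    using assms by (simp add: emeasure_coupling emeasure_coupling_n_void nn_integral_poisson_power)
  then show ?thesis
    by (simp add: algebra_simps flip: exp_add)
qed

section \<open>Marginals, union and independence\<close>

lemma prob_space_coupling: "prob_space coupling"
  using emeasure_coupling_void[of "{}" "{}"] by (intro prob_spaceI) (simp add: void_empty)

lemma emeasure_coupling_void_fst:
  assumes "A \<in> sets borel"
  shows "emeasure (distr coupling config fst) (void A) = ennreal (exp (- (x * t * measure mu A)))"
proof -
  \<comment> \<open>The empty set imposes no condition, so \<open>void {}\<close> in the other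
    coordinate yields the marginal.\<close>
  have "fst -` void A \<inter> space coupling = void A \<times> void {}"
    by (auto simp: void_def)
  then show ?thesis
    using assms by (simp add: emeasure_distr emeasure_coupling_void)
qed

lemma emeasure_coupling_void_snd:
  assumes "A \<in> sets borel"
  shows "emeasure (distr coupling config snd) (void A) = ennreal (exp (- ((1 - x) * t * measure mu A)))"
proof -
  have "snd -` void A \<inter> space coupling = void {} \<times> void A"
    by (auto simp: void_def)
  then show ?thesis
    using assms by (simp add: emeasure_distr emeasure_coupling_void)
qed

lemma measurable_Un_config [measurable]:
  "(\<lambda>w. fst w \<union> snd w) \<in> measurable (config \<Otimes>\<^sub>M config) (config :: 'a set measure)"
proof (rule measurable_config)
  fix A :: "'a set" assume A: "A \<in> sets borel"
  have "{w \<in> space (config \<Otimes>\<^sub>M config). (fst w \<union> snd w) \<inter> A = {}} = void A \<times> void A"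
    by (auto simp: space_pair_measure void_def)
  then show "{w \<in> space (config \<Otimes>\<^sub>M config). (fst w \<union> snd w) \<inter> A = {}}
      \<in> sets (config \<Otimes>\<^sub>M config)"
    using A by simp
qed (auto simp: space_pair_measure)

lemma emeasure_coupling_void_Un:
  assumes "A \<in> sets borel"
  shows "emeasure (distr coupling config (\<lambda>w. fst w \<union> snd w)) (void A)
    = ennreal (exp (- (t * measure mu A)))"
proof -
  have "(\<lambda>w. fst w \<union> snd w) -` void A \<inter> space coupling = void A \<times> void A"
    by (auto simp: void_def)
  then show ?thesis
    using assms
    by (simp add: emeasure_distr measurable_Un_config emeasure_coupling_void algebra_simps
        flip: exp_add)
qed

text \<open>This is the thinning theorem: joint void probabilities factor into the marginal ones,
  and they determine the joint law.\<close>

lemma coupling_eq_pair: "coupling = distr coupling config fst \<Otimes>\<^sub>M distr coupling config snd"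
proof (rule config_pair_law_eqI)
  interpret coupling: prob_space coupling by (rule prob_space_coupling)
  interpret snd: prob_space "distr coupling config snd"
    by (rule coupling.prob_space_distr) simp
  show "finite_measure coupling" by unfold_locales
  fix A B :: "'a set" assume "A \<in> sets borel" "B \<in> sets borel"
  then show "emeasure coupling (void A \<times> void B)
      = emeasure (distr coupling config fst \<Otimes>\<^sub>M distr coupling config snd) (void A \<times> void B)"
    by (simp add: snd.emeasure_pair_measure_Times emeasure_coupling_void ennreal_mult
        emeasure_coupling_void_fst emeasure_coupling_void_snd)
qed (auto intro: sets_pair_measure_cong)

section \<open>The event computed in two ways: every deleted point lies in the hull of the kept
  ones\<close>

definition good :: "('a set \<times> 'a set) set" where
  "good = {(K, D). finite K \<and> finite D \<and> D \<subseteq> convex hull K}"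

lemma sets_good [measurable]: "good \<in> sets (config \<Otimes>\<^sub>M config)"
  unfolding good_def by (rule sets_subset_hull)

text \<open>For fixed \<open>K\<close> the event says that the deleted process has no point outside
  the hull; its total intensity \<open>(1 - x) * t\<close> gives the exponent.\<close>

lemma emeasure_snd_section_good:
  assumes "finite K"
  shows "emeasure (distr coupling config snd) (Pair K -` good)
     = ennreal (exp (t * (x - 1) * missed_mass mu K))"
proof -
  have "Pair K -` good = void (UNIV - convex hull K)"
    using assms by (auto simp: good_def void_def)
  moreover have "UNIV - convex hull K \<in> sets borel"
    using assms by (auto simp: finite_imp_compact_convex_hull compact_imp_closed)
  ultimately show ?thesis
    by (simp add: emeasure_coupling_void_snd missed_mass_def algebra_simps)
qed

text \<open>The function equals the measure of a section of \<open>good\<close>, so its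
  measurability comes from the product structure without any study of
  \<open>missed_mass\<close>.\<close>

lemma measurable_exp_missed_mass:
  "(\<lambda>K. ennreal (exp (t * (x - 1) * missed_mass mu K))) \<in> borel_measurable config"
proof -
  interpret coupling: prob_space coupling by (rule prob_space_coupling)
  interpret snd: prob_space "distr coupling config snd"
    by (rule coupling.prob_space_distr) simp
  have "(\<lambda>K. emeasure (distr coupling config snd) (Pair K -` good)) \<in> borel_measurable config"
    by (rule snd.measurable_emeasure_Pair) (simp cong: sets_pair_measure_cong)
  then show ?thesis
    by (rule measurable_cong[THEN iffD1, rotated]) (simp add: emeasure_snd_section_good)
qed

text \<open>Conditioning on the kept points: by independence the deleted ones keep their law, and
  the measures of the sections of \<open>good\<close> can be integrated.\<close>

lemma emeasure_good_missed_mass: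
  "emeasure coupling good
     = (\<integral>\<^sup>+ K. ennreal (exp (t * (x - 1) * missed_mass mu K)) \<partial>distr coupling config fst)"
proof -
  interpret coupling: prob_space coupling by (rule prob_space_coupling)
  interpret snd: prob_space "distr coupling config snd"
    by (rule coupling.prob_space_distr) simp
  have "good \<in> sets (distr coupling config fst \<Otimes>\<^sub>M distr coupling config snd)"
    by (simp cong: sets_pair_measure_cong)
  from snd.emeasure_pair_measure_alt[OF this]
  have "emeasure coupling good
     = (\<integral>\<^sup>+ K. emeasure (distr coupling config snd) (Pair K -` good) \<partial>distr coupling config fst)"
    by (simp flip: coupling_eq_pair)
  also have "\<dots> = (\<integral>\<^sup>+ K. ennreal (exp (t * (x - 1) * missed_mass mu K)) \<partial>distr coupling config fst)"
    by (intro nn_integral_cong emeasure_snd_section_good) simp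
  finally show ?thesis .
qed

text \<open>Two coordinates coincide with probability zero: given all others, coordinate
  \<open>i\<close> would have to hit the single point \<open>X j\<close>, a null set of
  \<open>mu\<close>.\<close>

lemma AE_points_inj:
  assumes diffuse: "\<And>y. emeasure mu {y} = 0"
  shows "AE X in points n. inj_on X {..<n}"
proof -
  have "AE X in points n. X i \<noteq> X j" if ij: "i < n" "j < n" "i \<noteq> j" for i j
  proof -
    have [measurable]: "(\<lambda>X. X i) \<in> borel_measurable (points n)" "(\<lambda>X. X j) \<in> borel_measurable (points n)"
      using ij measurable_component_singleton[of _ "{..<n}" "\<lambda>_. mu"]
      by (auto cong: measurable_cong_sets)
    let ?E = "{X \<in> space (points n). X i = X j}"
    have E [measurable]: "?E \<in> sets (points n)" by measurable
    have n: "insert i ({..<n} - {i}) = {..<n}" using ij by auto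
    have "emeasure (points n) ?E = (\<integral>\<^sup>+ X. indicator ?E X \<partial>points n)"
      by simp
    also have "\<dots> = (\<integral>\<^sup>+ X. \<integral>\<^sup>+ y. indicator ?E (X(i := y)) \<partial>mu \<partial>PiM ({..<n} - {i}) (\<lambda>_. mu))"
      using product_sigma_finite.product_nn_integral_insert[OF product_sigma_finite_points,
          of "{..<n} - {i}" i "indicator ?E", unfolded n] by simp
    also have "\<dots> \<le> (\<integral>\<^sup>+ X. \<integral>\<^sup>+ y. indicator {X j} y \<partial>mu \<partial>PiM ({..<n} - {i}) (\<lambda>_. mu))"
      using ij by (intro nn_integral_mono) (auto simp: indicator_def)
    also have "\<dots> = 0"
      by (simp add: diffuse)
    finally have "emeasure (points n) ?E = 0" by simp
    then show ?thesis
      by (intro AE_I[OF _ _ E]) auto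
  qed
  then have "AE X in points n. \<forall>i\<in>{..<n}. \<forall>j\<in>{..<n}. i \<noteq> j \<longrightarrow> X i \<noteq> X j"
    by (intro AE_finite_allI finite_lessThan) (auto intro: AE_impI)
  then show ?thesis
    by eventually_elim (auto simp: inj_on_def)
qed

text \<open>If the deleted points lie in the hull of the kept ones, the hulls of the kept and of all
  points agree, so all vertices are kept; conversely the vertices span the hull. Injectivity
  identifies kept positions with kept indices.\<close>

lemma thin_in_good_iff:
  assumes inj: "inj_on X {..<n}"
  shows "thin n (X, B) \<in> good \<longleftrightarrow> (\<forall>i<n. X i \<in> vertices (X ` {..<n}) \<longrightarrow> B i)"
proof -
  let ?K = "X ` {i. i < n \<and> B i}" and ?D = "X ` {i. i < n \<and> \<not> B i}" and ?S = "X ` {..<n}"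
  have S: "?S = ?K \<union> ?D" by auto
  have "?D \<subseteq> convex hull ?K \<longleftrightarrow> vertices ?S \<subseteq> ?K"
  proof
    assume "?D \<subseteq> convex hull ?K"
    then have "?S \<subseteq> convex hull ?K"
      using S hull_subset[of ?K convex] by auto
    then have "convex hull ?S = convex hull ?K"
      using S by (intro subset_antisym hull_mono hull_minimal) auto
    then show "vertices ?S \<subseteq> ?K"
      using vertices_subset[of ?K] by simp
  next
    assume "vertices ?S \<subseteq> ?K"
    then have "convex hull ?S \<subseteq> convex hull ?K"
      using convex_hull_vertices[of ?S] hull_mono[of "vertices ?S" ?K convex] by simp
    then show "?D \<subseteq> convex hull ?K"
      using S hull_subset[of ?S convex] by blast
  qed
  also have "\<dots> \<longleftrightarrow> (\<forall>i<n. X i \<in> vertices ?S \<longrightarrow> X i \<in> ?K)"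
    using vertices_subset[of ?S] by blast
  also have "\<dots> \<longleftrightarrow> (\<forall>i<n. X i \<in> vertices ?S \<longrightarrow> B i)"
  proof -
    have "X i \<in> ?K \<longleftrightarrow> B i" if "i < n" for i
      using inj that by (auto simp: inj_on_def)
    then show ?thesis by blast
  qed
  finally show ?thesis
    by (simp add: good_def thin_def)
qed

text \<open>The marks are independent; each vertex contributes a factor \<open>x\<close> for being
  kept, every other point a factor 1.\<close>

lemma emeasure_marks_good:
  assumes inj: "inj_on X {..<n}"
  shows "(\<integral>\<^sup>+ B. indicator good (thin n (X, B)) \<partial>marks n) = ennreal (x ^ num_vertices (X ` {..<n}))"
proof -
  let ?V = "vertices (X ` {..<n})"
  let ?f = "\<lambda>i b. if X i \<in> ?V \<longrightarrow> b then 1 else (0 :: ennreal)"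
  have "indicator good (thin n (X, B)) = (\<Prod>i<n. ?f i (B i))" for B
  proof (cases "thin n (X, B) \<in> good")
    case True
    then show ?thesis
      unfolding thin_in_good_iff[OF inj] indicator_def by (subst prod.neutral) auto
  next
    case False
    then have "(\<Prod>i<n. ?f i (B i)) = 0"
      unfolding thin_in_good_iff[OF inj] by (intro prod_zero) auto
    then show ?thesis using False by simp
  qed
  then have "(\<integral>\<^sup>+ B. indicator good (thin n (X, B)) \<partial>marks n) = (\<integral>\<^sup>+ B. (\<Prod>i<n. ?f i (B i)) \<partial>marks n)"
    by simp
  also have "\<dots> = (\<Prod>i<n. \<integral>\<^sup>+ b. ?f i b \<partial>bernoulli_pmf x)"
    by (intro product_sigma_finite.product_nn_integral_prod[OF product_sigma_finite_marks]) auto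
  also have "\<dots> = (\<Prod>i<n. if X i \<in> ?V then ennreal x else 1)"
  proof (intro prod.cong refl)
    fix i
    have "ennreal x + ennreal (1 - x) = 1"
      using x by (simp flip: ennreal_plus)
    then show "(\<integral>\<^sup>+ b. ?f i b \<partial>bernoulli_pmf x) = (if X i \<in> ?V then ennreal x else 1)"
      using x by simp
  qed
  also have "\<dots> = ennreal x ^ card {i. i < n \<and> X i \<in> ?V}"
    by (simp add: prod.If_cases lessThan_def Int_def)
  \<comment> \<open>Injectivity equates the number of vertices with the number of indices carrying
    them.\<close>
  also have "card {i. i < n \<and> X i \<in> ?V} = num_vertices (X ` {..<n})"
  proof -
    have "?V = X ` {i. i < n \<and> X i \<in> ?V}"
      using vertices_subset[of "X ` {..<n}"] by blast
    moreover have "inj_on X {i. i < n \<and> X i \<in> ?V}"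
      using inj by (rule inj_on_subset) auto
    ultimately show ?thesis
      unfolding num_vertices_def by (metis (no_types, lifting) card_image)
  qed
  finally show ?thesis using x by (simp add: ennreal_power)
qed

text \<open>Conditioning on the positions: averaging over the marks leaves a power of
  \<open>x\<close> that depends on the union alone.\<close>

lemma emeasure_good_num_vertices:
  assumes diffuse: "\<And>y. emeasure mu {y} = 0"
  shows "emeasure coupling good
     = (\<integral>\<^sup>+ S. ennreal (x ^ num_vertices S) \<partial>distr coupling config (\<lambda>w. fst w \<union> snd w))"
proof -
  have [measurable]: "(\<lambda>S. ennreal (x ^ num_vertices S)) \<in> borel_measurable (config :: 'a set measure)"
    using measurable_num_vertices by measurable
  have "emeasure (coupling_n n) good
      = (\<integral>\<^sup>+ w. ennreal (x ^ num_vertices (fst w \<union> snd w)) \<partial>coupling_n n)" for n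
  proof -
    interpret marks: prob_space "marks n" by (rule prob_space_marks)
    have un: "fst (thin n (X, B)) \<union> snd (thin n (X, B)) = X ` {..<n}" for X B
      by (auto simp: thin_def)
    have "emeasure (coupling_n n) good
       = (\<integral>\<^sup>+ X. \<integral>\<^sup>+ B. indicator good (thin n (X, B)) \<partial>marks n \<partial>points n)"
      by (rule emeasure_coupling_n_iterated) simp
    also have "\<dots> = (\<integral>\<^sup>+ X. ennreal (x ^ num_vertices (X ` {..<n})) \<partial>points n)"
      using AE_points_inj[OF diffuse, of n]
      by (intro nn_integral_cong_AE) (auto elim!: eventually_mono simp: emeasure_marks_good)
    \<comment> \<open>The integrand does not depend on the marks, so a mark integral of total mass 1
      can be put back to reach a function of \<open>thin\<close>, hence an integral over
      \<open>coupling_n n\<close>.\<close>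
    also have "\<dots> = (\<integral>\<^sup>+ X. \<integral>\<^sup>+ B. ennreal (x ^ num_vertices (fst (thin n (X, B)) \<union> snd (thin n (X, B))))
        \<partial>marks n \<partial>points n)"
      by (simp add: un marks.emeasure_space_1)
    also have "\<dots> = (\<integral>\<^sup>+ w. ennreal (x ^ num_vertices (fst (thin n w) \<union> snd (thin n w)))
        \<partial>(points n \<Otimes>\<^sub>M marks n))"
      by (intro marks.nn_integral_fst) measurable
    also have "\<dots> = (\<integral>\<^sup>+ w. ennreal (x ^ num_vertices (fst w \<union> snd w)) \<partial>coupling_n n)"
      unfolding coupling_n_def by (intro nn_integral_distr[symmetric]) measurable
    finally show ?thesis .
  qed
  then have "emeasure coupling good = (\<integral>\<^sup>+ w. ennreal (x ^ num_vertices (fst w \<union> snd w)) \<partial>coupling)"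
    by (simp add: emeasure_coupling nn_integral_coupling)
  also have "\<dots> = (\<integral>\<^sup>+ S. ennreal (x ^ num_vertices S) \<partial>distr coupling config (\<lambda>w. fst w \<union> snd w))"
    by (intro nn_integral_distr[symmetric]) (simp_all cong: measurable_cong_sets)
  finally show ?thesis .
qed

end

section \<open>Laws of Poisson processes\<close>

text \<open>Avoiding \<open>A\<close> is a count of zero. Finiteness of \<open>eta w\<close> matters
  here: \<open>card\<close> is 0 on infinite sets as well.\<close>

lemma poisson_point_process_measurable:
  assumes "poisson_point_process M eta mu s"
  shows "eta \<in> measurable M config"
proof (rule measurable_config)
  show fin: "finite (eta w)" if "w \<in> space M" for w
    using assms that by (simp add: poisson_point_process_def)
  fix A :: "'b set" assume "A \<in> sets borel"
  then have "(\<lambda>w. card (eta w \<inter> A)) \<in> measurable M (count_space UNIV)"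
    using assms by (simp add: poisson_point_process_def)
  from measurable_sets[OF this, of "{0}"]
  have "(\<lambda>w. card (eta w \<inter> A)) -` {0} \<inter> space M \<in> sets M" by simp
  also have "(\<lambda>w. card (eta w \<inter> A)) -` {0} \<inter> space M = {w \<in> space M. eta w \<inter> A = {}}"
    using fin by auto
  finally show "{w \<in> space M. eta w \<inter> A = {}} \<in> sets M" .
qed

text \<open>The Poisson weight at \<open>k = 0\<close> is the void probability, and void
  probabilities determine the law on \<open>config\<close>.\<close>

lemma poisson_point_process_law_eqI:
  assumes ppp: "poisson_point_process M eta mu s"
    and Q: "sets Q = sets config"
      "\<And>A. A \<in> sets borel \<Longrightarrow> emeasure Q (void A) = ennreal (exp (- (s * measure mu A)))"
  shows "distr M config eta = Q"
proof (rule config_law_eqI)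
  interpret M: prob_space M using ppp by (simp add: poisson_point_process_def)
  note meas = poisson_point_process_measurable[OF ppp]
  show "finite_measure (distr M config eta)"
    using M.prob_space_distr[OF meas] by (simp add: prob_space_def)
  fix A :: "'b set" assume A: "A \<in> sets borel"
  have "eta -` void A \<inter> space M = {w \<in> space M. card (eta w \<inter> A) = 0}"
    using ppp by (auto simp: void_def poisson_point_process_def)
  moreover have "\<forall>k. measure M {w \<in> space M. card (eta w \<inter> A) = k}
      = (s * measure mu A) ^ k / fact k * exp (- (s * measure mu A))"
    using ppp A unfolding poisson_point_process_def by blast
  from this[rule_format, of 0]
  have "measure M {w \<in> space M. card (eta w \<inter> A) = 0} = exp (- (s * measure mu A))"
    by simp
  ultimately show "emeasure (distr M config eta) (void A) = emeasure Q (void A)"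
    using A by (simp add: emeasure_distr[OF meas] Q M.emeasure_eq_measure)
qed (use Q in auto)

theorem theorem4:
  fixes mu :: "'a::euclidean_space measure"
    and M :: "'w measure" and eta :: "'w \<Rightarrow> 'a set"
    and M' :: "'v measure" and eta' :: "'v \<Rightarrow> 'a set"
    and t x :: real
  assumes "prob_space mu" and "sets mu = sets borel"
    and "absolutely_continuous lborel mu"
    and "t > 0"
    and "x \<in> {0..1}"
    and "poisson_point_process M eta mu t"
    and "poisson_point_process M' eta' mu (x * t)"
  shows "prob_space.expectation M (\<lambda>w. x ^ num_vertices (eta w))
       = prob_space.expectation M' (\<lambda>w. exp (t * (x - 1) * missed_mass mu (eta' w)))"
proof -
  interpret marking mu t x
    using assms by (simp add: marking_def marking_axioms_def)
  \<comment> \<open>Singletons are Lebesgue null, so absolute continuity leaves \<open>mu\<close>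
    without atoms.\<close>
  have diffuse: "emeasure mu {y} = 0" for y
    using assms(3) unfolding absolutely_continuous_def null_sets_def
    by (metis (mono_tags, lifting) borel_singleton emeasure_lborel_singleton mem_Collect_eq
        sets.empty_sets sets_lborel subset_iff)
  note [measurable] = measurable_num_vertices
    poisson_point_process_measurable[OF assms(6)]
  \<comment> \<open>Both sides of the claim depend only on laws, so the given processes may live on
    unrelated spaces and are replaced by the union and the kept points of one coupling.\<close>
  have law: "distr M config eta = distr coupling config (\<lambda>w. fst w \<union> snd w)"
    by (rule poisson_point_process_law_eqI[OF assms(6)]) (simp_all add: emeasure_coupling_void_Un)
  have law': "distr M' config eta' = distr coupling config fst"
    by (rule poisson_point_process_law_eqI[OF assms(7)]) (simp_all add: emeasure_coupling_void_fst)
  have "prob_space.expectation M (\<lambda>w. x ^ num_vertices (eta w))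
      = enn2real (\<integral>\<^sup>+ w. ennreal (x ^ num_vertices (eta w)) \<partial>M)"
    using x by (intro integral_eq_nn_integral) auto
  also have "(\<integral>\<^sup>+ w. ennreal (x ^ num_vertices (eta w)) \<partial>M)
      = (\<integral>\<^sup>+ S. ennreal (x ^ num_vertices S) \<partial>distr M config eta)"
    by (intro nn_integral_distr[symmetric]) measurable
  \<comment> \<open>The two sides meet in the probability of \<open>good\<close>.\<close>
  also have "\<dots> = emeasure coupling good"
    unfolding law by (rule emeasure_good_num_vertices[OF diffuse, symmetric])
  also have "\<dots> = (\<integral>\<^sup>+ K. ennreal (exp (t * (x - 1) * missed_mass mu K)) \<partial>distr M' config eta')"
    unfolding law' by (rule emeasure_good_missed_mass)
  also have "\<dots> = (\<integral>\<^sup>+ w. ennreal (exp (t * (x - 1) * missed_mass mu (eta' w))) \<partial>M')"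
    by (intro nn_integral_distr poisson_point_process_measurable[OF assms(7)])
       (simp add: measurable_exp_missed_mass)
  also have "enn2real \<dots> = prob_space.expectation M' (\<lambda>w. exp (t * (x - 1) * missed_mass mu (eta' w)))"
  proof (rule integral_eq_nn_integral[symmetric])
    \<comment> \<open>The real integrand inherits measurability from its \<open>ennreal\<close>
      version through \<open>enn2real\<close>.\<close>
    have "(\<lambda>w. ennreal (exp (t * (x - 1) * missed_mass mu (eta' w)))) \<in> borel_measurable M'"
      by (rule measurable_compose[OF poisson_point_process_measurable[OF assms(7)]
            measurable_exp_missed_mass])
    from borel_measurable_enn2real[OF this] show "(\<lambda>w. exp (t * (x - 1) * missed_mass mu (eta' w))) \<in> borel_measurable M'"
      by simp
  qed simp
  finally show ?thesis .
qed

end
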